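(* Let $\mathcal{A}$ be an independence algebra with universe $A$, let $\mathcal{B}$ be a non-empty subalgebra of $\mathcal{A}$ with universe $B$, and let $T(\mathcal{A},\mathcal{B})$ be the semigroup of all endomorphisms of $\mathcal{A}$ whose image is contained in $B$. If $\mathcal{B}\neq\mathcal{A}$, then $T(\mathcal{A},\mathcal{B})$ is not a regular semigroup if and only if $\dim B\geq 2$, or $\langle\emptyset\rangle\neq\emptyset$ and $\dim B=1$.
   Context: An algebra $\mathcal{A}=\langle A;F\rangle$ has a non-empty universe $A$ and a set $F$ of finitary operations. For $X\subseteq A$, $\langle X\rangle$ is the set of all $t(a_1,\dots,a_n)$ with $t$ a term operation and $a_i\in X$ (the subalgebra generated by $X$); $\langle\emptyset\rangle$ is the set of constants, i.e. values of nullary term operations (possibly empty). $X$ is independent if $x\notin\langle X\setminus\{x\}\rangle$ for all $x\in X$; a basis of a subalgebra is an independent generating set. Exchange property (EP): for all $X\subseteq A$ and $a,b\in A$, if $b\in\langle X\cup\{a\}\rangle$ and $b\notin\langle X\rangle$ then $a\in\langle X\cup\{b\}\rangle$. Under (EP) every subalgebra has a basis, all its bases have the same cardinality (its dimension, $\dim$), and independent sets extend to bases. Free basis property (F): every map from a basis of $\mathcal{A}$ to $A$ extends to an endomorphism of $\mathcal{A}$. An independence algebra is an algebra satisfying (EP) and (F). Dimensions may be finite or infinite. A semigroup $S$ is regular if for every $a\in S$ there is $x\in S$ with $a=axa$. *)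

theory Defs
  imports Main "HOL-Library.FuncSet"
begin

unbundle cardinal_syntax

section \<open>Algebras, term operations and generated subalgebras\<close>

text \<open>
  A finitary operation is a pair \<open>(n, f)\<close> of an arity and a function on lists; only the values of
  \<open>f\<close> on lists of length \<open>n\<close> over the universe matter. Constants are operations of arity 0.
\<close>

type_synonym 'a operation = "nat \<times> ('a list \<Rightarrow> 'a)"

locale finitary_algebra =
  fixes A :: "'a set" and F :: "'a operation set"
  assumes nonempty: "A \<noteq> {}"
    and closed: "(n, f) \<in> F \<Longrightarrow> length xs = n \<Longrightarrow> set xs \<subseteq> A \<Longrightarrow> f xs \<in> A"

inductive term_operation :: "'a operation set \<Rightarrow> nat \<Rightarrow> ('a list \<Rightarrow> 'a) \<Rightarrow> bool"
  for F :: "'a operation set" and n :: nat where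
  projection: "i < n \<Longrightarrow> term_operation F n (\<lambda>xs. xs ! i)"
| composition: "(k, f) \<in> F \<Longrightarrow> length ts = k \<Longrightarrow> (\<And>t. t \<in> set ts \<Longrightarrow> term_operation F n t)
    \<Longrightarrow> term_operation F n (\<lambda>xs. f (map (\<lambda>t. t xs) ts))"

text \<open>
  For \<open>X = {}\<close> only \<open>n = 0\<close> contributes, so \<open>generated F {}\<close> consists of the values of the nullary
  term operations; a constant unary term operation does not by itself yield an element of it.
\<close>

definition generated :: "'a operation set \<Rightarrow> 'a set \<Rightarrow> 'a set" where
  "generated F X = {t as | t as. term_operation F (length as) t \<and> set as \<subseteq> X}"

definition subalgebra :: "'a set \<Rightarrow> 'a operation set \<Rightarrow> 'a set \<Rightarrow> bool" where
  "subalgebra A F B \<longleftrightarrow> B \<subseteq> A \<and> (\<forall>(n, f) \<in> F. \<forall>xs. length xs = n \<and> set xs \<subseteq> B \<longrightarrow> f xs \<in> B)"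

section \<open>Independence, bases and dimension\<close>

definition independent :: "'a operation set \<Rightarrow> 'a set \<Rightarrow> bool" where
  "independent F X \<longleftrightarrow> (\<forall>x \<in> X. x \<notin> generated F (X - {x}))"

definition basis_of :: "'a operation set \<Rightarrow> 'a set \<Rightarrow> 'a set \<Rightarrow> bool" where
  "basis_of F B X \<longleftrightarrow> X \<subseteq> B \<and> independent F X \<and> generated F X = B"

text \<open>
  The dimension is a cardinal, compared by \<open>\<le>o\<close> and \<open>=o\<close>. The choice of the basis is immaterial for
  subalgebras of an algebra with the exchange property, where bases exist and are equipotent.
\<close>

definition dimension :: "'a operation set \<Rightarrow> 'a set \<Rightarrow> 'a rel" where
  "dimension F B = |SOME X. basis_of F B X|"

section \<open>Endomorphisms and independence algebras\<close>

text \<open>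
  Endomorphisms are taken extensional (undefined outside \<open>A\<close>), so that equality of
  endomorphisms in HOL is equality of maps on the universe.
\<close>

definition endomorphisms :: "'a set \<Rightarrow> 'a operation set \<Rightarrow> ('a \<Rightarrow> 'a) set" where
  "endomorphisms A F = {\<phi> \<in> A \<rightarrow>\<^sub>E A.
     \<forall>(n, f) \<in> F. \<forall>xs. length xs = n \<and> set xs \<subseteq> A \<longrightarrow> \<phi> (f xs) = f (map \<phi> xs)}"

locale independence_algebra = finitary_algebra +
  assumes exchange: "X \<subseteq> A \<Longrightarrow> a \<in> A \<Longrightarrow> b \<in> A \<Longrightarrow> b \<in> generated F (X \<union> {a}) \<Longrightarrow>
      b \<notin> generated F X \<Longrightarrow> a \<in> generated F (X \<union> {b})"
    and free_basis: "basis_of F A X \<Longrightarrow> g \<in> X \<rightarrow> A \<Longrightarrow>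
      \<exists>\<phi> \<in> endomorphisms A F. \<forall>x \<in> X. \<phi> x = g x"

section \<open>The semigroup of endomorphisms with restricted range\<close>

definition endomorphisms_into :: "'a set \<Rightarrow> 'a operation set \<Rightarrow> 'a set \<Rightarrow> ('a \<Rightarrow> 'a) set" where
  "endomorphisms_into A F B = {\<phi> \<in> endomorphisms A F. \<phi> ` A \<subseteq> B}"

definition semigroup_on :: "'s set \<Rightarrow> ('s \<Rightarrow> 's \<Rightarrow> 's) \<Rightarrow> bool" where
  "semigroup_on S m \<longleftrightarrow> (\<forall>a \<in> S. \<forall>b \<in> S. m a b \<in> S) \<and>
     (\<forall>a \<in> S. \<forall>b \<in> S. \<forall>c \<in> S. m (m a b) c = m a (m b c))"

definition regular_semigroup_on :: "'s set \<Rightarrow> ('s \<Rightarrow> 's \<Rightarrow> 's) \<Rightarrow> bool" where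
  "regular_semigroup_on S m \<longleftrightarrow> semigroup_on S m \<and> (\<forall>a \<in> S. \<exists>x \<in> S. a = m (m a x) a)"

text \<open>
  \<open>T(A, B)\<close> is always a semigroup, so failing to be a regular semigroup means failing regularity.
\<close>

lemma (in finitary_algebra) semigroup_endomorphisms_into:
  assumes "subalgebra A F B"
  shows "semigroup_on (endomorphisms_into A F B) (compose A)"
proof -
  have BA: "B \<subseteq> A" using assms by (simp add: subalgebra_def)
  have cl: "compose A \<phi> \<psi> \<in> endomorphisms_into A F B"
    if p: "\<phi> \<in> endomorphisms_into A F B" and q: "\<psi> \<in> endomorphisms_into A F B" for \<phi> \<psi>
  proof -
    have maps: "\<phi> \<in> A \<rightarrow> B" "\<psi> \<in> A \<rightarrow> B"
      using p q by (auto simp: endomorphisms_into_def)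
    have "compose A \<phi> \<psi> (f xs) = f (map (compose A \<phi> \<psi>) xs)"
      if F: "(n, f) \<in> F" and len: "length xs = n" and xs: "set xs \<subseteq> A" for n f xs
    proof -
      have ys: "set (map \<psi> xs) \<subseteq> A" using xs maps BA by auto
      have "compose A \<phi> \<psi> (f xs) = \<phi> (\<psi> (f xs))"
        using closed[OF F len xs] by (simp add: compose_def)
      also have "\<psi> (f xs) = f (map \<psi> xs)"
        using q F len xs by (auto simp: endomorphisms_into_def endomorphisms_def)
      also have "\<phi> (f (map \<psi> xs)) = f (map \<phi> (map \<psi> xs))"
        using p F len ys unfolding endomorphisms_into_def endomorphisms_def by fastforce
      also have "map \<phi> (map \<psi> xs) = map (compose A \<phi> \<psi>) xs"
        using xs by (auto simp: compose_def)
      finally show ?thesis .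
    qed
    moreover have "compose A \<phi> \<psi> \<in> A \<rightarrow>\<^sub>E A" "compose A \<phi> \<psi> ` A \<subseteq> B"
      using maps BA by (auto simp: compose_def)
    ultimately show ?thesis
      by (auto simp: endomorphisms_into_def endomorphisms_def)
  qed
  have "compose A (compose A \<phi> \<psi>) \<chi> = compose A \<phi> (compose A \<psi> \<chi>)"
    if "\<chi> \<in> endomorphisms_into A F B" for \<phi> \<psi> \<chi> :: "'a \<Rightarrow> 'a"
    using that BA by (auto simp: endomorphisms_into_def compose_def fun_eq_iff)
  with cl show ?thesis by (simp add: semigroup_on_def)
qed

end

theory Submission
  imports Defs
begin

text \<open>
  Let \<open>X\<close> be a basis of \<open>B\<close>, extended to a basis \<open>Y\<close> of \<open>A\<close>. If \<open>\<phi> = \<phi> \<psi> \<phi>\<close> with \<open>\<psi>\<close> mapping into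
  \<open>B\<close>, then \<open>\<phi>\<close> maps \<open>A\<close> into \<open>\<phi>(B)\<close>. If some \<open>x \<in> X\<close> and \<open>d \<in> \<langle>X - {x}\<rangle>\<close> exist, the endomorphism
  sending \<open>X\<close> to \<open>d\<close> and \<open>Y - X\<close> to \<open>x\<close> violates this, because \<open>x\<close> lies in its image but not in \<open>\<langle>d\<rangle>\<close>.
  The remaining cases are \<open>B = \<langle>\<emptyset>\<rangle>\<close>, where all maps in question fix \<open>B\<close> pointwise, and \<open>B = \<langle>b\<rangle>\<close>
  without constants, where the exchange property makes every \<open>\<phi>\<close> map \<open>B\<close> onto \<open>B\<close>; then any \<open>\<psi>\<close>
  sending \<open>Y\<close> to a preimage of \<open>b\<close> works.
\<close>

section \<open>Generated subalgebras\<close>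

text \<open>Substituting variables turns projections into projections and passes through
  compositions. This moves a term to a longer or reordered argument list.\<close>

lemma term_operation_reindex:
  assumes "term_operation F n t" and "\<And>i. i < n \<Longrightarrow> r i < m"
  shows "term_operation F m (\<lambda>xs. t (map (\<lambda>i. xs ! r i) [0..<n]))"
  using assms(1)
proof induction
  case (projection i)
  then have "(\<lambda>xs :: 'a list. map (\<lambda>i. xs ! r i) [0..<n] ! i) = (\<lambda>xs. xs ! r i)"
    by simp
  then show ?case
    using projection assms(2) by (simp add: term_operation.projection)
next
  case (composition k f ts)
  let ?s = "\<lambda>t xs. t (map (\<lambda>i. xs ! r i) [0..<n])"
  have "term_operation F m (\<lambda>xs. f (map (\<lambda>t. t xs) (map ?s ts)))"
    using composition by (intro term_operation.composition) auto
  then show ?case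
    by (simp add: comp_def)
qed

text \<open>Each argument of the witnessing term occurs at some position of \<open>bs\<close>;
  reindexing along these positions yields a term in all of \<open>bs\<close>.\<close>

lemma generated_list:
  assumes "e \<in> generated F (set bs)"
  shows "\<exists>t. term_operation F (length bs) t \<and> t bs = e"
proof -
  obtain t as where t: "term_operation F (length as) t" "e = t as" "set as \<subseteq> set bs"
    using assms by (auto simp: generated_def)
  have "\<forall>i. \<exists>j. i < length as \<longrightarrow> j < length bs \<and> bs ! j = as ! i"
    using t(3) by (metis in_set_conv_nth subset_code(1))
  then obtain r where r: "\<And>i. i < length as \<Longrightarrow> r i < length bs \<and> bs ! r i = as ! i"
    by metis
  have "map (\<lambda>i. bs ! r i) [0..<length as] = as"
    using r by (auto intro: nth_equalityI)
  then show ?thesis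
    using term_operation_reindex[OF t(1), of r "length bs"] r t(2)
    by (intro exI[of _ "\<lambda>xs. t (map (\<lambda>i. xs ! r i) [0..<length as])"]) auto
qed

lemma generated_mono: "X \<subseteq> Y \<Longrightarrow> generated F X \<subseteq> generated F Y"
  by (auto simp: generated_def)

lemma generated_superset: "X \<subseteq> generated F X"
proof
  fix x assume "x \<in> X"
  then show "x \<in> generated F X"
    using term_operation.projection[of 0 1 F]
    by (auto simp: generated_def intro!: exI[of _ "\<lambda>xs. xs ! 0"] exI[of _ "[x]"])
qed

lemma generated_finite:
  assumes "e \<in> generated F X"
  obtains as where "set as \<subseteq> X" "e \<in> generated F (set as)"
  using assms by (auto simp: generated_def)

text \<open>Composition requires terms of one common arity, whereas the entries of \<open>es\<close>
  come with unrelated argument lists. Concatenating these lists into \<open>bs\<close> provides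
  common arguments for all of them.\<close>

lemma generated_operation:
  assumes f: "(n, f) \<in> F" and len: "length es = n" and es: "set es \<subseteq> generated F X"
  shows "f es \<in> generated F X"
proof -
  have "\<forall>e. \<exists>as. e \<in> generated F X \<longrightarrow> set as \<subseteq> X \<and> e \<in> generated F (set as)"
    by (metis generated_finite)
  then obtain s where s: "\<And>e. e \<in> generated F X \<Longrightarrow> set (s e) \<subseteq> X \<and> e \<in> generated F (set (s e))"
    by metis
  define bs where "bs = concat (map s es)"
  have bs: "set bs \<subseteq> X"
    using es s by (fastforce simp: bs_def)
  have "\<exists>t. term_operation F (length bs) t \<and> t bs = e" if "e \<in> set es" for e
  proof (rule generated_list)
    have "generated F (set (s e)) \<subseteq> generated F (set bs)"
      using that by (intro generated_mono) (auto simp: bs_def)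
    then show "e \<in> generated F (set bs)"
      using that es s by blast
  qed
  then obtain t where t: "\<And>e. e \<in> set es \<Longrightarrow> term_operation F (length bs) (t e) \<and> t e bs = e"
    by metis
  have "term_operation F (length bs) (\<lambda>xs. f (map (\<lambda>u. u xs) (map t es)))"
    using f len t by (intro term_operation.composition) auto
  moreover have "map (\<lambda>u. u bs) (map t es) = es"
    using t by (auto intro: map_idI)
  ultimately show ?thesis
    using bs unfolding generated_def
    by (intro CollectI exI[of _ "\<lambda>xs. f (map (\<lambda>u. u xs) (map t es))"] exI[of _ bs]) simp
qed

text \<open>Induction on a term evaluated at one fixed list becomes induction on elements, so later
  proofs need not handle terms.\<close>

lemma generated_induct [consumes 1, case_names generator operation]:
  assumes "e \<in> generated F X"
    and gen: "\<And>x. x \<in> X \<Longrightarrow> P x"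
    and op: "\<And>n f xs. (n, f) \<in> F \<Longrightarrow> length xs = n \<Longrightarrow> (\<And>x. x \<in> set xs \<Longrightarrow> P x) \<Longrightarrow> P (f xs)"
  shows "P e"
proof -
  obtain t as where t: "term_operation F (length as) t" "e = t as" "set as \<subseteq> X"
    using assms(1) by (auto simp: generated_def)
  have "P (t as)"
    using t(1)
  proof induction
    case (projection i)
    then show ?case
      using gen t(3) nth_mem by blast
  next
    case (composition k f ts)
    then show ?case
      by (intro op[OF composition(1)]) auto
  qed
  then show ?thesis
    using t(2) by simp
qed

lemma generated_subset_subalgebra:
  assumes "subalgebra A F B" and "X \<subseteq> B"
  shows "generated F X \<subseteq> B"
proof
  fix e assume "e \<in> generated F X"
  then show "e \<in> B"
    using assms by (induction rule: generated_induct) (fastforce simp: subalgebra_def)+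
qed

lemma generated_subset_generated:
  assumes "X \<subseteq> generated F Y"
  shows "generated F X \<subseteq> generated F Y"
proof
  fix e assume "e \<in> generated F X"
  then show "e \<in> generated F Y"
    using assms by (induction rule: generated_induct) (auto intro: generated_operation)
qed

lemma (in finitary_algebra) subalgebra_universe: "subalgebra A F A"
  using closed by (auto simp: subalgebra_def)

section \<open>Endomorphisms on generated subalgebras\<close>

lemma endomorphisms_apply:
  assumes "\<phi> \<in> endomorphisms A F" "(n, f) \<in> F" "length xs = n" "set xs \<subseteq> A"
  shows "\<phi> (f xs) = f (map \<phi> xs)"
  using assms by (auto simp: endomorphisms_def)

lemma (in finitary_algebra) endomorphism_fixes_generated:
  assumes \<phi>: "\<phi> \<in> endomorphisms A F" and X: "X \<subseteq> A" and fixed: "\<And>x. x \<in> X \<Longrightarrow> \<phi> x = x"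
    and e: "e \<in> generated F X"
  shows "\<phi> e = e"
proof -
  \<comment> \<open>Membership in \<open>A\<close> is carried along because \<open>\<phi>\<close>
    commutes with operations only on arguments from \<open>A\<close>.\<close>
  have "e \<in> A \<and> \<phi> e = e"
    using e
  proof (induction rule: generated_induct)
    case (operation n f xs)
    then have "set xs \<subseteq> A" "map \<phi> xs = xs"
      by (auto intro: map_idI)
    then show ?case
      using operation(1,2) closed[of n f xs] endomorphisms_apply[OF \<phi>, of n f xs] by simp
  qed (use X fixed in auto)
  then show ?thesis
    by simp
qed

lemma (in finitary_algebra) endomorphism_image_generated:
  assumes \<phi>: "\<phi> \<in> endomorphisms A F" and X: "X \<subseteq> A"
  shows "\<phi> ` generated F X = generated F (\<phi> ` X)"
proof (intro subset_antisym subsetI)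
  fix y assume "y \<in> \<phi> ` generated F X"
  then obtain e where e: "e \<in> generated F X" and y: "y = \<phi> e"
    by blast
  have "e \<in> A \<and> \<phi> e \<in> generated F (\<phi> ` X)"
    using e
  proof (induction rule: generated_induct)
    case (generator x)
    then show ?case
      using X generated_superset[of "\<phi> ` X" F] by auto
  next
    case (operation n f xs)
    then have "set xs \<subseteq> A" and "f (map \<phi> xs) \<in> generated F (\<phi> ` X)"
      using generated_operation[OF operation(1), of "map \<phi> xs"] by auto
    then show ?case
      using operation(1,2) closed[of n f xs] endomorphisms_apply[OF \<phi>, of n f xs] by simp
  qed
  then show "y \<in> generated F (\<phi> ` X)"
    using y by simp
next
  fix y assume "y \<in> generated F (\<phi> ` X)"
  then show "y \<in> \<phi> ` generated F X"
  proof (induction rule: generated_induct)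
    case (generator y)
    then show ?case
      using generated_superset[of X F] by auto
  next
    case (operation n f ys)
    \<comment> \<open>A list over an image is the image of a list, so preimages are chosen for all
      arguments at once.\<close>
    then have "ys \<in> lists (\<phi> ` generated F X)"
      by auto
    then obtain xs where xs: "set xs \<subseteq> generated F X" "ys = map \<phi> xs"
      by (auto simp: lists_image)
    moreover have "generated F X \<subseteq> A"
      using X subalgebra_universe by (rule generated_subset_subalgebra[rotated])
    ultimately have "\<phi> (f xs) = f ys" "f xs \<in> generated F X"
      using operation(1,2) endomorphisms_apply[OF \<phi>, of n f xs] generated_operation[of n f F xs X]
      by auto
    then show ?case
      by (metis imageI)
  qed
qed

section \<open>Bases\<close>

text \<open>A new dependence of some \<open>x\<close> in \<open>X\<close> would have to involve
  \<open>a\<close>; exchange then puts \<open>a\<close> into the subalgebra generated by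
  \<open>X\<close>.\<close>

lemma (in independence_algebra) independent_insert:
  assumes X: "X \<subseteq> A" "independent F X" and a: "a \<in> A" "a \<notin> generated F X"
  shows "independent F (insert a X)"
  unfolding independent_def
proof
  fix x assume x: "x \<in> insert a X"
  have aX: "a \<notin> X"
    using a(2) generated_superset[of X F] by blast
  show "x \<notin> generated F (insert a X - {x})"
  proof (cases "x = a")
    case True
    then show ?thesis
      using a(2) aX by simp
  next
    case False
    then have xX: "x \<in> X"
      using x by simp
    show ?thesis
    proof
      assume "x \<in> generated F (insert a X - {x})"
      moreover have "insert a X - {x} = (X - {x}) \<union> {a}"
        using False by auto
      moreover have "x \<notin> generated F (X - {x})"
        using X(2) xX by (simp add: independent_def)
      ultimately have "a \<in> generated F ((X - {x}) \<union> {x})"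
        using exchange[of "X - {x}" a x] X(1) xX a(1) by auto
      then show False
        using a(2) xX by (simp add: insert_absorb)
    qed
  qed
qed

text \<open>A dependence uses only finitely many elements, and these already lie in one member of
  the chain.\<close>

lemma independent_Union_chain:
  assumes "subset.chain {Y. independent F Y} \<C>"
  shows "independent F (\<Union>\<C>)"
  unfolding independent_def
proof (intro ballI notI)
  fix x assume x: "x \<in> \<Union>\<C>" and gen: "x \<in> generated F (\<Union>\<C> - {x})"
  obtain as where as: "set as \<subseteq> \<Union>\<C> - {x}" "x \<in> generated F (set as)"
    by (rule generated_finite[OF gen])
  have "finite (insert x (set as))" "insert x (set as) \<subseteq> \<Union>\<C>" "\<C> \<noteq> {}"
    using as(1) x by auto
  then obtain Y where Y: "Y \<in> \<C>" "insert x (set as) \<subseteq> Y"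
    by (rule finite_subset_Union_chain[OF _ _ _ assms])
  have "x \<in> generated F (Y - {x})"
    using as Y(2) generated_mono[of "set as" "Y - {x}" F] by blast
  moreover have "independent F Y"
    using assms Y(1) by (auto simp: subset.chain_def)
  ultimately show False
    using Y(2) by (simp add: independent_def)
qed

text \<open>Zorn's lemma gives a maximal independent set between \<open>X\<close> and
  \<open>B\<close>; by \<open>independent_insert\<close> it generates \<open>B\<close>.\<close>

lemma (in independence_algebra) basis_extension:
  assumes B: "subalgebra A F B" and X: "X \<subseteq> B" "independent F X"
  obtains Y where "X \<subseteq> Y" "basis_of F B Y"
proof -
  let ?S = "{Y. X \<subseteq> Y \<and> Y \<subseteq> B \<and> independent F Y}"
  have "\<exists>U\<in>?S. \<forall>Z\<in>\<C>. Z \<subseteq> U" if \<C>: "subset.chain ?S \<C>" for \<C>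
  \<comment> \<open>The union of the empty chain need not contain \<open>X\<close>, so there
    \<open>X\<close> itself serves as the upper bound.\<close>
  proof (cases "\<C> = {}")
    case True
    then show ?thesis
      using X by auto
  next
    case False
    have "subset.chain {Y. independent F Y} \<C>"
      using \<C> by (auto simp: subset.chain_def)
    then have "independent F (\<Union>\<C>)"
      by (rule independent_Union_chain)
    moreover have "X \<subseteq> \<Union>\<C>" "\<Union>\<C> \<subseteq> B"
      using \<C> False unfolding subset.chain_def by blast+
    ultimately show ?thesis
      by (intro bexI[of _ "\<Union>\<C>"]) auto
  qed
  then have "\<exists>Y\<in>?S. \<forall>Z\<in>?S. Y \<subseteq> Z \<longrightarrow> Z = Y"
    by (rule subset_Zorn)
  then obtain Y where Y: "Y \<in> ?S" and max: "\<forall>Z\<in>?S. Y \<subseteq> Z \<longrightarrow> Z = Y"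
    by (rule bexE)
  have BA: "B \<subseteq> A"
    using B by (simp add: subalgebra_def)
  have "B \<subseteq> generated F Y"
  proof (rule ccontr)
    assume "\<not> B \<subseteq> generated F Y"
    then obtain a where a: "a \<in> B" "a \<notin> generated F Y"
      by blast
    then have "insert a Y \<in> ?S"
      using Y BA independent_insert[of Y a] by auto
    then have "a \<in> Y"
      using bspec[OF max, of "insert a Y"] by auto
    then show False
      using a(2) generated_superset[of Y F] by blast
  qed
  moreover have "generated F Y \<subseteq> B"
    using Y by (intro generated_subset_subalgebra[OF B]) auto
  ultimately have "basis_of F B Y"
    using Y by (auto simp: basis_of_def)
  then show thesis
    using Y that by auto
qed

text \<open>The empty set is independent and extends to a basis, so the set chosen by
  \<open>SOME\<close> in \<open>dimension\<close> is itself a basis.\<close>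

lemma (in independence_algebra) dimension_basis:
  assumes "subalgebra A F B"
  obtains X where "basis_of F B X" "dimension F B = |X|"
proof -
  have "\<exists>X. basis_of F B X"
    using basis_extension[OF assms, of "{}"] by (auto simp: independent_def)
  then have "basis_of F B (SOME X. basis_of F B X)"
    by (rule someI_ex)
  then show thesis
    using that by (simp add: dimension_def)
qed

text \<open>The image of \<open>A\<close> is generated by the image of \<open>Y\<close>, so it lies
  in \<open>B\<close> once the values on \<open>Y\<close> do.\<close>

lemma (in independence_algebra) endomorphism_into_extension:
  assumes B: "subalgebra A F B" and Y: "basis_of F A Y" and g: "g \<in> Y \<rightarrow> B"
  obtains \<phi> where "\<phi> \<in> endomorphisms_into A F B" "\<forall>y\<in>Y. \<phi> y = g y"
proof -
  have "g \<in> Y \<rightarrow> A"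
    using B g by (auto simp: subalgebra_def)
  then obtain \<phi> where \<phi>: "\<phi> \<in> endomorphisms A F" "\<forall>y\<in>Y. \<phi> y = g y"
    using free_basis[OF Y] by blast
  have "\<phi> ` A = generated F (\<phi> ` Y)"
    using Y endomorphism_image_generated[OF \<phi>(1), of Y] by (simp add: basis_of_def)
  also have "\<dots> \<subseteq> B"
    using g \<phi>(2) by (intro generated_subset_subalgebra[OF B]) auto
  finally show thesis
    using \<phi> by (intro that[of \<phi>]) (auto simp: endomorphisms_into_def)
qed

section \<open>Regularity\<close>

text \<open>\<open>ctwo\<close> is the cardinal of \<open>bool\<close>, and an injection from
  \<open>bool\<close> is a pair of distinct elements.\<close>

lemma ctwo_ordLeq_iff: "ctwo \<le>o |X| \<longleftrightarrow> (\<exists>x\<in>X. \<exists>y\<in>X. x \<noteq> y)"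
proof
  assume "ctwo \<le>o |X|"
  then obtain f :: "bool \<Rightarrow> 'a" where "inj f" "range f \<subseteq> X"
    unfolding ctwo_def card_of_ordLeq[symmetric] by blast
  then have "f True \<in> X" "f False \<in> X" "f True \<noteq> f False"
    by (auto dest: injD)
  then show "\<exists>x\<in>X. \<exists>y\<in>X. x \<noteq> y"
    by blast
next
  assume "\<exists>x\<in>X. \<exists>y\<in>X. x \<noteq> y"
  then obtain x y where "x \<in> X" "y \<in> X" "x \<noteq> y"
    by blast
  then have "inj (\<lambda>b. if b then x else y)" "range (\<lambda>b. if b then x else y) \<subseteq> X"
    by (auto simp: inj_def)
  then show "ctwo \<le>o |X|"
    unfolding ctwo_def card_of_ordLeq[symmetric] by blast
qed

lemma ordIso_cone_iff: "|X| =o cone \<longleftrightarrow> (\<exists>x. X = {x})"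
proof
  assume "|X| =o cone"
  then obtain f where "bij_betw f X {()}"
    unfolding cone_def card_of_ordIso[symmetric] by blast
  then have "card X = 1"
    by (simp add: bij_betw_same_card)
  then show "\<exists>x. X = {x}"
    by (simp add: card_1_singleton_iff)
next
  assume "\<exists>x. X = {x}"
  then obtain x where "X = {x}" ..
  then have "bij_betw (\<lambda>_. ()) X {()}"
    by (simp add: bij_betw_def)
  then show "|X| =o cone"
    unfolding cone_def card_of_ordIso[symmetric] by blast
qed

lemma (in finitary_algebra) regular_endomorphisms_into_iff:
  assumes B: "subalgebra A F B"
  shows "regular_semigroup_on (endomorphisms_into A F B) (compose A) \<longleftrightarrow>
    (\<forall>\<phi>\<in>endomorphisms_into A F B. \<exists>\<psi>\<in>endomorphisms_into A F B. \<forall>a\<in>A. \<phi> (\<psi> (\<phi> a)) = \<phi> a)"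
proof -
  have "\<phi> = compose A (compose A \<phi> \<psi>) \<phi> \<longleftrightarrow> (\<forall>a\<in>A. \<phi> (\<psi> (\<phi> a)) = \<phi> a)"
    if "\<phi> \<in> endomorphisms_into A F B" for \<phi> \<psi> :: "'a \<Rightarrow> 'a"
  proof -
    have \<phi>: "\<phi> \<in> A \<rightarrow>\<^sub>E A"
      using that by (simp add: endomorphisms_into_def endomorphisms_def)
    then have comp: "compose A (compose A \<phi> \<psi>) \<phi> a = (if a \<in> A then \<phi> (\<psi> (\<phi> a)) else undefined)" for a
      by (auto simp: compose_def)
    show ?thesis
    proof
      assume "\<phi> = compose A (compose A \<phi> \<psi>) \<phi>"
      then show "\<forall>a\<in>A. \<phi> (\<psi> (\<phi> a)) = \<phi> a"
        using comp by metis
    next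
      assume *: "\<forall>a\<in>A. \<phi> (\<psi> (\<phi> a)) = \<phi> a"
      show "\<phi> = compose A (compose A \<phi> \<psi>) \<phi>"
      proof
        fix a
        show "\<phi> a = compose A (compose A \<phi> \<psi>) \<phi> a"
          \<comment> \<open>Outside \<open>A\<close> both sides are
            \<open>undefined\<close>.\<close>
          using * \<phi> comp[of a] by (auto dest: PiE_arb)
      qed
    qed
  qed
  then show ?thesis
    using semigroup_endomorphisms_into[OF B] by (simp add: regular_semigroup_on_def)
qed

text \<open>The element \<open>d\<close> treats both conditions on the dimension uniformly: it may
  be a second basis element or a constant.\<close>

lemma (in independence_algebra) not_regular_endomorphisms_into:
  assumes B: "subalgebra A F B" "B \<noteq> A" and X: "basis_of F B X"
    and x: "x \<in> X" and d: "d \<in> generated F (X - {x})"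
  shows "\<not> regular_semigroup_on (endomorphisms_into A F B) (compose A)"
proof
  assume reg: "regular_semigroup_on (endomorphisms_into A F B) (compose A)"
  have BA: "B \<subseteq> A" and XB: "X \<subseteq> B" "independent F X" "generated F X = B"
    using B(1) X by (auto simp: subalgebra_def basis_of_def)
  then obtain Y where Y: "X \<subseteq> Y" "basis_of F A Y"
    using basis_extension[OF subalgebra_universe, of X] by blast
  moreover have "X \<noteq> Y"
    using XB(3) B(2) Y(2) by (auto simp: basis_of_def)
  ultimately obtain y where y: "y \<in> Y" "y \<notin> X"
    by blast
  have dB: "d \<in> B"
    using d XB(3) generated_mono[of "X - {x}" X F] by blast
  then have g: "(\<lambda>z. if z \<in> X then d else x) \<in> Y \<rightarrow> B"
    using x XB(1) by auto
  obtain \<phi> where \<phi>: "\<phi> \<in> endomorphisms_into A F B"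
    and ext: "\<forall>z\<in>Y. \<phi> z = (if z \<in> X then d else x)"
    by (rule endomorphism_into_extension[OF B(1) Y(2) g])
  obtain \<psi> where \<psi>: "\<psi> \<in> endomorphisms_into A F B" "\<forall>a\<in>A. \<phi> (\<psi> (\<phi> a)) = \<phi> a"
    using reg \<phi> regular_endomorphisms_into_iff[OF B(1)] by blast
  have yA: "y \<in> A"
    using Y(2) y(1) by (auto simp: basis_of_def)
  have "\<phi> (\<psi> (\<phi> y)) = x"
    using \<psi>(2) yA ext y by auto
  \<comment> \<open>Regularity yields a preimage of \<open>x\<close> inside \<open>B\<close>,
    although \<open>y\<close> lies outside \<open>X\<close>.\<close>
  moreover have "\<psi> (\<phi> y) \<in> B"
    using \<phi> \<psi>(1) yA BA by (auto simp: endomorphisms_into_def)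
  ultimately have "x \<in> \<phi> ` B"
    by blast
  also have "\<phi> ` B = generated F (\<phi> ` X)"
    using endomorphism_image_generated[of \<phi> X] \<phi> XB BA by (auto simp: endomorphisms_into_def)
  \<comment> \<open>\<open>\<phi>\<close> sends all of \<open>X\<close> to \<open>d\<close>, so
    \<open>x\<close> would depend on the rest of the basis.\<close>
  also have "\<dots> \<subseteq> generated F (X - {x})"
    using d ext Y(1) by (intro generated_subset_generated) auto
  finally show False
    using XB(2) x by (simp add: independent_def)
qed

text \<open>Values of \<open>\<phi>\<close> are constants, which endomorphisms fix; hence
  \<open>\<phi>\<close> is its own witness.\<close>

lemma (in finitary_algebra) regular_endomorphisms_into_constants:
  assumes "subalgebra A F (generated F {})"
  shows "regular_semigroup_on (endomorphisms_into A F (generated F {})) (compose A)"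
proof -
  have "\<phi> (\<phi> (\<phi> a)) = \<phi> a"
    if "\<phi> \<in> endomorphisms_into A F (generated F {})" "a \<in> A" for \<phi> a
  proof -
    have "\<phi> a \<in> generated F {}" "\<phi> \<in> endomorphisms A F"
      using that by (auto simp: endomorphisms_into_def)
    then have "\<phi> (\<phi> a) = \<phi> a"
      using endomorphism_fixes_generated[of \<phi> "{}" "\<phi> a"] by simp
    then show ?thesis
      by simp
  qed
  then show ?thesis
    unfolding regular_endomorphisms_into_iff[OF assms] by blast
qed

lemma (in independence_algebra) regular_endomorphisms_into_singleton:
  assumes B: "subalgebra A F B" and b: "basis_of F B {b}" and no_const: "generated F {} = {}"
  shows "regular_semigroup_on (endomorphisms_into A F B) (compose A)"
  unfolding regular_endomorphisms_into_iff[OF B]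
proof
  fix \<phi> assume \<phi>: "\<phi> \<in> endomorphisms_into A F B"
  then have endo: "\<phi> \<in> endomorphisms A F" and into: "\<phi> ` A \<subseteq> B"
    by (auto simp: endomorphisms_into_def)
  have BA: "B \<subseteq> A" and bB: "b \<in> B" "independent F {b}" "generated F {b} = B"
    using B b by (auto simp: subalgebra_def basis_of_def)
  have "\<phi> b \<in> B"
    using into bB(1) BA by blast
  \<comment> \<open>Exchange over the empty set: \<open>\<phi> b\<close> is generated by
    \<open>b\<close> and, in the absence of constants, not by the empty set.\<close>
  then have "b \<in> generated F {\<phi> b}"
    using exchange[of "{}" b "\<phi> b"] bB BA no_const by auto
  also have "generated F {\<phi> b} = \<phi> ` B"
    using endomorphism_image_generated[OF endo, of "{b}"] bB BA by auto
  finally obtain c where c: "c \<in> B" "\<phi> c = b"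
    by auto
  obtain Y where Y: "{b} \<subseteq> Y" "basis_of F A Y"
    using basis_extension[OF subalgebra_universe, of "{b}"] bB BA by blast
  obtain \<psi> where \<psi>: "\<psi> \<in> endomorphisms_into A F B" "\<forall>y\<in>Y. \<psi> y = c"
    using endomorphism_into_extension[OF B Y(2), of "\<lambda>_. c"] c(1) by auto
  have \<psi>A: "\<psi> ` A \<subseteq> B" "\<psi> \<in> endomorphisms A F"
    using \<psi>(1) by (auto simp: endomorphisms_into_def)
  \<comment> \<open>The composite fixes the generator \<open>b\<close>, hence all of
    \<open>B\<close>, which contains every value of \<open>\<phi>\<close>.\<close>
  have "compose A \<phi> \<psi> \<in> endomorphisms_into A F B"
    using semigroup_endomorphisms_into[OF B] \<phi> \<psi>(1) by (simp add: semigroup_on_def)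
  then have "compose A \<phi> \<psi> \<in> endomorphisms A F"
    by (simp add: endomorphisms_into_def)
  moreover have "compose A \<phi> \<psi> b = b"
    using \<psi>(2) Y(1) c(2) bB(1) BA by (auto simp: compose_def)
  ultimately have "compose A \<phi> \<psi> e = e" if "e \<in> B" for e
    using endomorphism_fixes_generated[of "compose A \<phi> \<psi>" "{b}" e] that bB BA by auto
  then have "\<phi> (\<psi> e) = e" if "e \<in> B" for e
    using that BA compose_eq[of e A \<phi> \<psi>] by auto
  then show "\<exists>\<psi>\<in>endomorphisms_into A F B. \<forall>a\<in>A. \<phi> (\<psi> (\<phi> a)) = \<phi> a"
    using \<psi>(1) into by blast
qed

theorem corollary3p2:
  fixes A B :: "'a set" and F :: "'a operation set"
  assumes "independence_algebra A F"
    and "subalgebra A F B" and "B \<noteq> {}"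
    and "B \<noteq> A"
  shows "\<not> regular_semigroup_on (endomorphisms_into A F B) (compose A) \<longleftrightarrow>
    ctwo \<le>o dimension F B \<or> (generated F {} \<noteq> {} \<and> dimension F B =o cone)"
proof -
  interpret independence_algebra A F
    by (fact assms(1))
  obtain X where X: "basis_of F B X" and dim: "dimension F B = |X|"
    by (rule dimension_basis[OF assms(2)])
  have rhs: "ctwo \<le>o dimension F B \<or> (generated F {} \<noteq> {} \<and> dimension F B =o cone) \<longleftrightarrow>
      (\<exists>x\<in>X. \<exists>y\<in>X. x \<noteq> y) \<or> (generated F {} \<noteq> {} \<and> (\<exists>x. X = {x}))"
    by (simp add: dim ctwo_ordLeq_iff ordIso_cone_iff)
  show ?thesis
    unfolding rhs
  proof
    assume "(\<exists>x\<in>X. \<exists>y\<in>X. x \<noteq> y) \<or> (generated F {} \<noteq> {} \<and> (\<exists>x. X = {x}))"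
    \<comment> \<open>Two distinct basis elements give \<open>d = y\<close>; for a singleton basis,
      \<open>X - {x}\<close> is empty and \<open>d\<close> is any constant.\<close>
    then obtain x d where "x \<in> X" "d \<in> generated F (X - {x})"
    proof (elim disjE bexE conjE exE)
      fix x y assume "x \<in> X" "y \<in> X" "x \<noteq> y"
      then show thesis
        using that[of x y] generated_superset[of "X - {x}" F] by auto
    next
      fix x assume "generated F {} \<noteq> {}" "X = {x}"
      then show thesis
        using that[of x] by auto
    qed
    then show "\<not> regular_semigroup_on (endomorphisms_into A F B) (compose A)"
      using not_regular_endomorphisms_into assms(2,4) X by blast
  next
    assume not_reg: "\<not> regular_semigroup_on (endomorphisms_into A F B) (compose A)"
    show "(\<exists>x\<in>X. \<exists>y\<in>X. x \<noteq> y) \<or> (generated F {} \<noteq> {} \<and> (\<exists>x. X = {x}))"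
    proof (rule ccontr)
      assume neg: "\<not> ?thesis"
      \<comment> \<open>With no two distinct elements, \<open>X\<close> is empty or a singleton, and
        the singleton case excludes constants.\<close>
      then consider "X = {}" | b where "X = {b}" "generated F {} = {}"
        by blast
      then show False
      proof cases
        case 1
        then have "B = generated F {}"
          using X by (simp add: basis_of_def)
        then show False
          using regular_endomorphisms_into_constants assms(2) not_reg by simp
      next
        case 2
        then show False
          using regular_endomorphisms_into_singleton assms(2) X not_reg by simp
      qed
    qed
  qed
qed

end
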